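(* Let $h\in H^2(\mathbb{D})$ with $h(0)\neq0$. If $f(z,w)=h(\chi_k(z,w))$ for some integer $k\ge1$, then for each integer $n\ge0$ the $n$-th optimal polynomial approximant $p_n^*[f]$ to $1/f$ in $H^2(\mathbb{D}^2)$ has no zeros in the closed bidisk $\overline{\mathbb{D}}^2$.
   Context: $\mathbb{D}$ is the open unit disk in $\mathbb{C}$; $H^2(\mathbb{D})$ is the classical Hardy space on the disk, and $H^2(\mathbb{D}^2)$ is the Hardy space on the bidisk: holomorphic functions on $\mathbb{D}^2$ with square-summable Taylor coefficients, with inner product $\langle f,g\rangle=\sum_{i,j\ge0}a_{i,j}\overline{b_{i,j}}$ for $f=\sum a_{i,j}z^iw^j$, $g=\sum b_{i,j}z^iw^j$. The monomials in $z,w$ are enumerated in degree lexicographic order (increasing total degree; within total degree $d$ the order is $z^d, z^{d-1}w,\dots,w^d$): $\chi_0=1,\ \chi_1=z,\ \chi_2=w,\ \chi_3=z^2,\ \chi_4=zw,\ \chi_5=w^2,\dots$. Put $\mathcal{P}_n=\operatorname{span}\{\chi_0,\dots,\chi_n\}$. If $h\in H^2(\mathbb{D})$ and $k\ge 1$, then $h(\chi_k)$ is an element of $H^2(\mathbb{D}^2)$. For $f\in H^2(\mathbb{D}^2)$ not identically zero and $n\ge0$, the $n$-th optimal polynomial approximant (OPA) to $1/f$, denoted $p_n^*[f]$, is the unique $p\in\mathcal{P}_n$ minimizing $\|pf-1\|$ over $\mathcal{P}_n$; equivalently, $p_n^*[f]f$ is the orthogonal projection of $1$ onto $\mathcal{P}_nf=\{pf:p\in\mathcal{P}_n\}$.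 *)

theory Defs
  imports "HOL-Complex_Analysis.Complex_Analysis" "HOL-Library.Nat_Bijection"
begin

definition hardy_disk :: "(complex \<Rightarrow> complex) set" where
  "hardy_disk = {h. h holomorphic_on ball 0 1 \<and>
      summable (\<lambda>n. (cmod ((deriv ^^ n) h 0 / fact n))\<^sup>2)}"

definition bidisk :: "(complex \<times> complex) set" where
  "bidisk = ball 0 1 \<times> ball 0 1"

definition closed_bidisk :: "(complex \<times> complex) set" where
  "closed_bidisk = cball 0 1 \<times> cball 0 1"

text \<open>Holomorphy in two variables on an open set: the real Frechet derivative exists
  at every point and is complex linear.\<close>

definition holomorphic2_on :: "(complex \<times> complex \<Rightarrow> complex) \<Rightarrow> (complex \<times> complex) set \<Rightarrow> bool" where
  "holomorphic2_on f S \<longleftrightarrow>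
     (\<forall>x\<in>S. \<exists>a b. (f has_derivative (\<lambda>(u, v). a * u + b * v)) (at x))"

definition taylor_coeff2 :: "(complex \<times> complex \<Rightarrow> complex) \<Rightarrow> nat \<Rightarrow> nat \<Rightarrow> complex" where
  "taylor_coeff2 f i j =
     (deriv ^^ i) (\<lambda>z. (deriv ^^ j) (\<lambda>w. f (z, w)) 0) 0 / (fact i * fact j)"

definition hardy_bidisk :: "(complex \<times> complex \<Rightarrow> complex) set" where
  "hardy_bidisk = {f. holomorphic2_on f bidisk \<and>
      (\<lambda>(i, j). (cmod (taylor_coeff2 f i j))\<^sup>2) summable_on UNIV}"

text \<open>The norm is only meaningful on \<open>hardy_bidisk\<close>: \<^const>\<open>infsum\<close> is 0 when the
  coefficients are not square-summable.\<close>

definition hardy_norm2 :: "(complex \<times> complex \<Rightarrow> complex) \<Rightarrow> real" where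
  "hardy_norm2 f = sqrt (\<Sum>\<^sub>\<infinity>(i, j). (cmod (taylor_coeff2 f i j))\<^sup>2)"

text \<open>\<^const>\<open>prod_decode\<close> is the inverse of \<open>(m, n) \<mapsto> triangle (m + n) + m\<close>, so it
  enumerates pairs by increasing sum and then increasing first component. Taking the first
  component as the exponent of \<open>w\<close> gives the degree lexicographic order
  \<open>1, z, w, z^2, z w, w^2, \<dots>\<close>.\<close>

definition chi :: "nat \<Rightarrow> complex \<times> complex \<Rightarrow> complex" where
  "chi k = (\<lambda>(z, w). z ^ snd (prod_decode k) * w ^ fst (prod_decode k))"

lemma chi_deg_lex:
  assumes "j \<le> d"
  shows "chi (triangle d + j) (z, w) = z ^ (d - j) * w ^ j"
proof -
  have "prod_encode (j, d - j) = triangle d + j"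
    using assms by (simp add: prod_encode_def)
  then have "prod_decode (triangle d + j) = (j, d - j)"
    by (metis prod_encode_inverse)
  then show ?thesis
    by (simp add: chi_def)
qed

definition poly_space :: "nat \<Rightarrow> (complex \<times> complex \<Rightarrow> complex) set" where
  "poly_space n = {p. \<exists>c. p = (\<lambda>x. \<Sum>k\<le>n. c k * chi k x)}"

definition is_opa :: "nat \<Rightarrow> (complex \<times> complex \<Rightarrow> complex) \<Rightarrow> (complex \<times> complex \<Rightarrow> complex) \<Rightarrow> bool" where
  "is_opa n f p \<longleftrightarrow> f \<in> hardy_bidisk \<and> (\<exists>x\<in>bidisk. f x \<noteq> 0) \<and> p \<in> poly_space n \<and>
     (\<forall>q\<in>poly_space n. hardy_norm2 (\<lambda>x. p x * f x - 1) \<le> hardy_norm2 (\<lambda>x. q x * f x - 1))"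

text \<open>Elements of \<^const>\<open>poly_space\<close> are functions on the whole of \<open>\<complex>\<^sup>2\<close>, so an optimal
  approximant can be evaluated on the closed bidisk although \<open>f\<close> matters only on the open one.\<close>

definition opa :: "nat \<Rightarrow> (complex \<times> complex \<Rightarrow> complex) \<Rightarrow> complex \<times> complex \<Rightarrow> complex" where
  "opa n f = (THE p. is_opa n f p)"

end

theory Submission imports Defs begin

text \<open>Write \<open>\<chi>\<^sub>k = z\<^sup>a w\<^sup>b\<close>. The coefficients of \<open>f\<close> live on the ray
  \<open>{(m a, m b)}\<close>, and multiplying \<open>f\<close> by a monomial that is not a power of \<open>\<chi>\<^sub>k\<close> moves them off
  it. Hence projecting \<open>1\<close> onto the span of the \<open>\<chi>\<^sub>k\<^sup>m f\<close> with \<open>\<chi>\<^sub>k\<^sup>m\<close> in \<open>\<P>\<^sub>n\<close> already gives the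
  projection onto \<open>\<P>\<^sub>n f\<close>, so the approximant is \<open>G(\<chi>\<^sub>k)\<close> for a polynomial \<open>G\<close> in one variable.
  Since multiplication by \<open>\<chi>\<^sub>k\<close> is an isometry with range orthogonal to \<open>1\<close>, \<open>G\<close> has no root in
  the closed disk.\<close>

section \<open>Square-summable families and their inner product\<close>

definition sq_summable :: "('i \<Rightarrow> complex) \<Rightarrow> bool" where
  "sq_summable a \<longleftrightarrow> (\<lambda>x. (cmod (a x))\<^sup>2) summable_on UNIV"

text \<open>\<open>infsum\<close> returns 0 on families that are not summable; on square-summable
  arguments this is the usual inner product.\<close>

definition ell2_inner :: "('i \<Rightarrow> complex) \<Rightarrow> ('i \<Rightarrow> complex) \<Rightarrow> complex" where
  "ell2_inner a b = (\<Sum>\<^sub>\<infinity>x. a x * cnj (b x))"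

lemma sq_summable_finite_support:
  assumes "finite {x. a x \<noteq> 0}"
  shows "sq_summable a"
  unfolding sq_summable_def
  by (rule summable_on_cong_neutral[THEN iffD1, OF _ _ _ summable_on_finite[OF assms]]) auto

lemma sq_summable_scale:
  assumes "sq_summable a"
  shows "sq_summable (\<lambda>x. c * a x)"
  using summable_on_cmult_right[of "\<lambda>x. (cmod (a x))\<^sup>2" UNIV "(cmod c)\<^sup>2"] assms
  by (simp add: sq_summable_def norm_mult power_mult_distrib)

lemma sq_summable_add:
  assumes "sq_summable a" "sq_summable b"
  shows "sq_summable (\<lambda>x. a x + b x)"
proof -
  have "(\<lambda>x. 2 * (cmod (a x))\<^sup>2 + 2 * (cmod (b x))\<^sup>2) summable_on UNIV"
    using assms unfolding sq_summable_def by (intro summable_on_add summable_on_cmult_right)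
  moreover have "(cmod (a x + b x))\<^sup>2 \<le> 2 * (cmod (a x))\<^sup>2 + 2 * (cmod (b x))\<^sup>2" for x
  proof -
    have "(cmod (a x + b x))\<^sup>2 \<le> (cmod (a x) + cmod (b x))\<^sup>2"
      by (intro power_mono norm_triangle_ineq) auto
    also have "\<dots> \<le> 2 * (cmod (a x))\<^sup>2 + 2 * (cmod (b x))\<^sup>2"
      using zero_le_power2[of "cmod (a x) - cmod (b x)"]
      by (simp add: power2_sum power2_diff)
    finally show ?thesis .
  qed
  ultimately show ?thesis
    unfolding sq_summable_def by (rule summable_on_comparison_test) auto
qed

lemma sq_summable_diff:
  assumes "sq_summable a" "sq_summable b"
  shows "sq_summable (\<lambda>x. a x - b x)"
  using sq_summable_add[OF assms(1) sq_summable_scale[OF assms(2), of "-1"]] by simp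

lemma sq_summable_sum:
  assumes "\<And>m. m \<in> A \<Longrightarrow> sq_summable (v m)"
  shows "sq_summable (\<lambda>x. \<Sum>m\<in>A. v m x)"
  using assms
proof (induction A rule: infinite_finite_induct)
  case (insert m A)
  then show ?case
    using sq_summable_add[of "v m" "\<lambda>x. \<Sum>m\<in>A. v m x"] by simp
qed (simp_all add: sq_summable_def)

text \<open>The bound 2|ab| <= |a|^2 + |b|^2 supplies a summable majorant.\<close>

lemma ell2_inner_summable:
  assumes "sq_summable a" "sq_summable b"
  shows "(\<lambda>x. a x * cnj (b x)) summable_on UNIV"
proof (rule Infinite_Sum.abs_summable_summable, rule Infinite_Sum.abs_summable_on_comparison_test')
  show "(\<lambda>x. (cmod (a x))\<^sup>2 + (cmod (b x))\<^sup>2) summable_on UNIV"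
    using assms unfolding sq_summable_def by (rule summable_on_add)
  show "norm (a x * cnj (b x)) \<le> (cmod (a x))\<^sup>2 + (cmod (b x))\<^sup>2" for x
  proof -
    have "2 * (cmod (a x) * cmod (b x)) \<le> (cmod (a x))\<^sup>2 + (cmod (b x))\<^sup>2"
      using zero_le_power2[of "cmod (a x) - cmod (b x)"] by (simp add: power2_diff)
    then show ?thesis
      using mult_nonneg_nonneg[OF norm_ge_zero[of "a x"] norm_ge_zero[of "b x"]]
      unfolding norm_mult complex_mod_cnj by linarith
  qed
qed

lemma ell2_inner_add_left:
  assumes "sq_summable a" "sq_summable b" "sq_summable c"
  shows "ell2_inner (\<lambda>x. a x + b x) c = ell2_inner a c + ell2_inner b c"
  unfolding ell2_inner_def
  using infsum_add[OF ell2_inner_summable[OF assms(1,3)] ell2_inner_summable[OF assms(2,3)]]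
  by (simp add: distrib_right)

lemma ell2_inner_scale_left: "ell2_inner (\<lambda>x. k * a x) c = k * ell2_inner a c"
  by (simp add: ell2_inner_def mult.assoc infsum_cmult_right')

lemma ell2_inner_diff_left:
  assumes "sq_summable a" "sq_summable b" "sq_summable c"
  shows "ell2_inner (\<lambda>x. a x - b x) c = ell2_inner a c - ell2_inner b c"
  using ell2_inner_add_left[OF assms(1) sq_summable_scale[OF assms(2), of "-1"] assms(3)]
    ell2_inner_scale_left[of "-1" b c] by simp

lemma ell2_inner_sum_left:
  assumes "\<And>m. m \<in> A \<Longrightarrow> sq_summable (v m)" "sq_summable c"
  shows "ell2_inner (\<lambda>x. \<Sum>m\<in>A. v m x) c = (\<Sum>m\<in>A. ell2_inner (v m) c)"
  using assms(1)
proof (induction A rule: infinite_finite_induct)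
  case (insert m A)
  then show ?case
    using ell2_inner_add_left[of "v m" "\<lambda>x. \<Sum>m\<in>A. v m x" c] sq_summable_sum[of A v] assms(2)
    by simp
qed (simp_all add: ell2_inner_def)

lemma ell2_inner_commute: "ell2_inner b a = cnj (ell2_inner a b)"
  by (simp add: ell2_inner_def flip: infsum_cnj) (simp add: mult.commute)

lemma ell2_inner_add_right:
  assumes "sq_summable a" "sq_summable b" "sq_summable c"
  shows "ell2_inner c (\<lambda>x. a x + b x) = ell2_inner c a + ell2_inner c b"
  using ell2_inner_add_left[OF assms] by (metis ell2_inner_commute complex_cnj_add)

lemma ell2_inner_diff_right:
  assumes "sq_summable a" "sq_summable b" "sq_summable c"
  shows "ell2_inner c (\<lambda>x. a x - b x) = ell2_inner c a - ell2_inner c b"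
  using ell2_inner_diff_left[OF assms] by (metis ell2_inner_commute complex_cnj_diff)

lemma ell2_inner_scale_right: "ell2_inner c (\<lambda>x. k * a x) = cnj k * ell2_inner c a"
  using ell2_inner_scale_left[of k a c] by (metis ell2_inner_commute complex_cnj_mult)

lemma ell2_inner_sum_right:
  assumes "\<And>m. m \<in> A \<Longrightarrow> sq_summable (v m)" "sq_summable c"
  shows "ell2_inner c (\<lambda>x. \<Sum>m\<in>A. v m x) = (\<Sum>m\<in>A. ell2_inner c (v m))"
proof -
  have "ell2_inner c (\<lambda>x. \<Sum>m\<in>A. v m x) = cnj (\<Sum>m\<in>A. ell2_inner (v m) c)"
    by (subst ell2_inner_commute) (use ell2_inner_sum_left[of A v c] assms in simp)
  then show ?thesis
    by (simp add: ell2_inner_commute[of c])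
qed

lemma ell2_inner_self:
  assumes "sq_summable a"
  shows "ell2_inner a a = of_real (\<Sum>\<^sub>\<infinity>x. (cmod (a x))\<^sup>2)"
proof -
  have "(\<lambda>x. a x * cnj (a x)) = (\<lambda>x. of_real ((cmod (a x))\<^sup>2))"
    by (simp add: complex_norm_square del: of_real_power)
  moreover have "((\<lambda>x. complex_of_real ((cmod (a x))\<^sup>2)) has_sum of_real (\<Sum>\<^sub>\<infinity>x. (cmod (a x))\<^sup>2)) UNIV"
    using assms unfolding sq_summable_def by (intro has_sum_of_real has_sum_infsum)
  ultimately show ?thesis
    unfolding ell2_inner_def by (simp add: infsumI)
qed

lemma Re_ell2_inner_self_nonneg: "sq_summable a \<Longrightarrow> 0 \<le> Re (ell2_inner a a)"
  by (simp add: ell2_inner_self infsum_nonneg)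

lemma ell2_inner_self_le_0D:
  assumes "sq_summable a" "Re (ell2_inner a a) \<le> 0"
  shows "a = (\<lambda>x. 0)"
proof
  fix x
  have "(cmod (a x))\<^sup>2 = 0"
    using assms nonneg_infsum_le_0D[of "\<lambda>x. (cmod (a x))\<^sup>2" UNIV x]
    by (simp add: ell2_inner_self sq_summable_def)
  then show "a x = 0" by simp
qed

lemma ell2_inner_disjoint:
  assumes "\<And>x. a x = 0 \<or> b x = 0"
  shows "ell2_inner a b = 0"
  unfolding ell2_inner_def using assms by (intro infsum_0) (metis complex_cnj_zero mult_eq_0_iff)

lemma ell2_pythagoras:
  assumes "sq_summable a" "sq_summable b" "ell2_inner a b = 0"
  shows "ell2_inner (\<lambda>x. a x + b x) (\<lambda>x. a x + b x) = ell2_inner a a + ell2_inner b b"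
  using assms ell2_inner_commute[of b a]
  by (simp add: ell2_inner_add_left ell2_inner_add_right sq_summable_add)

text \<open>Gram-Schmidt by induction on \<open>N\<close>: the residual \<open>r\<close> of
  \<open>u\<close> is corrected along the residual \<open>e\<close> of the new vector
  \<open>w N\<close>. The family may be dependent, so \<open>e\<close> can be zero.\<close>

lemma ell2_projection_exists:
  fixes w :: "nat \<Rightarrow> 'i \<Rightarrow> complex"
  assumes "\<And>m. sq_summable (w m)" "sq_summable u"
  shows "\<exists>c. \<forall>i<N. ell2_inner (\<lambda>x. u x - (\<Sum>m<N. c m * w m x)) (w i) = 0"
  using assms(2)
proof (induction N arbitrary: u)
  case (Suc N)
  have S: "sq_summable (\<lambda>x. \<Sum>m<N. c m * w m x)" for c
    by (intro sq_summable_sum sq_summable_scale assms)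
  obtain c where c: "\<And>i. i < N \<Longrightarrow> ell2_inner (\<lambda>x. u x - (\<Sum>m<N. c m * w m x)) (w i) = 0"
    using Suc by blast
  obtain d where d: "\<And>i. i < N \<Longrightarrow> ell2_inner (\<lambda>x. w N x - (\<Sum>m<N. d m * w m x)) (w i) = 0"
    using Suc.IH[OF assms(1)[of N]] by blast
  define r where "r = (\<lambda>x. u x - (\<Sum>m<N. c m * w m x))"
  define e where "e = (\<lambda>x. w N x - (\<Sum>m<N. d m * w m x))"
  \<comment> \<open>If \<open>e\<close> is zero, division by zero gives \<open>t = 0\<close>; the
    identity \<open>t\<close> below then holds because both sides vanish.\<close>
  define t where "t = ell2_inner r e / ell2_inner e e"
  define s where "s = (\<lambda>x. r x - t * e x)"
  have sq: "sq_summable r" "sq_summable e" "sq_summable s"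
    unfolding s_def r_def e_def
    by (intro sq_summable_diff sq_summable_scale S Suc.prems assms)+
  have t: "t * ell2_inner e e = ell2_inner r e"
  proof (cases "ell2_inner e e = 0")
    case True
    then have "e = (\<lambda>x. 0)"
      using ell2_inner_self_le_0D[OF sq(2)] by simp
    then show ?thesis by (simp add: ell2_inner_def)
  qed (simp add: t_def)
  have s1: "ell2_inner s (w i) = 0" if "i < N" for i
    unfolding s_def
    using that c[of i] d[of i] sq assms(1)
    by (simp add: ell2_inner_diff_left ell2_inner_scale_left sq_summable_scale
        flip: r_def e_def)
  have "ell2_inner s e = 0"
    unfolding s_def using t sq
    by (simp add: ell2_inner_diff_left ell2_inner_scale_left sq_summable_scale)
  \<comment> \<open>Up to a combination of the earlier vectors, \<open>e\<close> is
    \<open>w N\<close>; orthogonality to \<open>e\<close> and to those vectors therefore passes to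
    \<open>w N\<close>.\<close>
  moreover have "ell2_inner s e = ell2_inner s (w N) - ell2_inner s (\<lambda>x. \<Sum>m<N. d m * w m x)"
    unfolding e_def by (intro ell2_inner_diff_right assms S sq)
  moreover have "ell2_inner s (\<lambda>x. \<Sum>m<N. d m * w m x) = 0"
    using s1 sq assms(1)
    by (simp add: ell2_inner_sum_right ell2_inner_scale_right sq_summable_scale)
  ultimately have s2: "ell2_inner s (w N) = 0" by simp
  define c' where "c' = (\<lambda>m. if m = N then t else c m - t * d m)"
  have "s = (\<lambda>x. u x - (\<Sum>m<Suc N. c' m * w m x))"
    by (auto simp: s_def r_def e_def c'_def algebra_simps sum_subtractf sum_distrib_left)
  then show ?case
    using s1 s2 by (metis less_Suc_eq)
qed simp

section \<open>Multiplication by monomials as a shift of double sequences\<close>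

definition shift :: "nat \<Rightarrow> nat \<Rightarrow> (nat \<times> nat \<Rightarrow> complex) \<Rightarrow> nat \<times> nat \<Rightarrow> complex" where
  "shift s t u = (\<lambda>(i, j). if s \<le> i \<and> t \<le> j then u (i - s, j - t) else 0)"

lemma shift_shift: "shift s t (shift s' t' u) = shift (s + s') (t + t') u"
  by (auto simp: shift_def fun_eq_iff add.commute)

lemma shift_0 [simp]: "shift 0 0 u = u"
  by (auto simp: shift_def)

lemma shift_sum: "shift s t (\<lambda>x. \<Sum>m\<in>A. c m * v m x) = (\<lambda>x. \<Sum>m\<in>A. c m * shift s t (v m) x)"
  by (auto simp: shift_def fun_eq_iff)

text \<open>Reindexing along the injection \<open>e\<close>, off whose range the shifted sequence is
  0. The weight \<open>g\<close> is left general to cover both squared moduli and the terms of a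
  power series.\<close>

lemma has_sum_shift:
  fixes g :: "nat \<times> nat \<Rightarrow> complex \<Rightarrow> 'b :: {comm_monoid_add, topological_space}"
  assumes "\<And>x. g x 0 = 0"
  shows "((\<lambda>x. g x (shift s t u x)) has_sum S) UNIV \<longleftrightarrow>
    ((\<lambda>(i, j). g (i + s, j + t) (u (i, j))) has_sum S) UNIV"
proof -
  define e where "e = (\<lambda>(i::nat, j::nat). (i + s, j + t))"
  have inj: "inj e" by (auto simp: inj_def e_def)
  have "shift s t u x = 0" if "x \<notin> range e" for x
  proof (rule ccontr)
    assume "shift s t u x \<noteq> 0"
    then have "s \<le> fst x" "t \<le> snd x"
      by (auto simp: shift_def split: prod.splits if_splits)
    then have "x = e (fst x - s, snd x - t)"
      by (simp add: e_def)
    with that show False by blast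
  qed
  then have "((\<lambda>x. g x (shift s t u x)) has_sum S) UNIV \<longleftrightarrow>
      ((\<lambda>x. g x (shift s t u x)) has_sum S) (range e)"
    by (intro has_sum_cong_neutral) (auto simp: assms)
  also have "\<dots> \<longleftrightarrow> ((\<lambda>x. g x (shift s t u x)) \<circ> e has_sum S) UNIV"
    by (rule has_sum_reindex[OF inj])
  also have "(\<lambda>x. g x (shift s t u x)) \<circ> e = (\<lambda>(i, j). g (i + s, j + t) (u (i, j)))"
    by (auto simp: e_def shift_def)
  finally show ?thesis .
qed

lemma shift_norm:
  "((\<lambda>x. (cmod (shift s t u x))\<^sup>2) has_sum S) UNIV \<longleftrightarrow> ((\<lambda>x. (cmod (u x))\<^sup>2) has_sum S) UNIV"
  using has_sum_shift[of "\<lambda>_ y. (cmod y)\<^sup>2" s t u S] by (simp add: case_prod_unfold)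

lemma sq_summable_shift [simp]: "sq_summable (shift s t u) \<longleftrightarrow> sq_summable u"
  by (simp add: sq_summable_def summable_on_def shift_norm)

lemma ell2_inner_self_shift:
  assumes "sq_summable u"
  shows "ell2_inner (shift s t u) (shift s t u) = ell2_inner u u"
proof -
  have "((\<lambda>x. (cmod (shift s t u x))\<^sup>2) has_sum (\<Sum>\<^sub>\<infinity>x. (cmod (u x))\<^sup>2)) UNIV"
    using assms unfolding shift_norm sq_summable_def by (rule has_sum_infsum)
  then show ?thesis
    using assms by (simp add: ell2_inner_self infsumI)
qed

section \<open>The coefficients of the constant function 1, and roots of the projecting
  polynomial\<close>

definition delta :: "nat \<times> nat \<Rightarrow> complex" where
  "delta x = (if x = (0, 0) then 1 else 0)"

lemma sq_summable_delta: "sq_summable delta"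
  by (rule sq_summable_finite_support, rule finite_subset[of _ "{(0, 0)}"]) (auto simp: delta_def)

lemma ell2_inner_delta: "ell2_inner delta v = cnj (v (0, 0))"
  unfolding ell2_inner_def
  by (rule infsumI, rule has_sum_finite_neutralI[of "{(0, 0)}"]) (auto simp: delta_def)

text \<open>The sequence attached to a polynomial \<open>G\<close> is \<open>T G = \<Sum>\<^sub>m G\<^sub>m S\<^sup>m u\<close> with the isometric shift
  \<open>S\<close>. If \<open>G = (X - \<lambda>) R\<close> and \<open>F = T R\<close>, then \<open>T G = S F - \<lambda> F\<close>. Orthogonality against \<open>S F\<close>
  gives \<open>\<parallel>F\<parallel>\<^sup>2 = \<lambda> \<langle>F, S F\<rangle>\<close>, hence \<open>\<parallel>S F - \<lambda> F\<parallel>\<^sup>2 = (\<bar>\<lambda>\<bar>\<^sup>2 - 1) \<parallel>F\<parallel>\<^sup>2\<close>.\<close>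

lemma orthogonal_poly_no_root:
  fixes G :: "complex poly" and u :: "nat \<times> nat \<Rightarrow> complex" and N a b :: nat
  defines "T \<equiv> \<lambda>P x. \<Sum>m\<le>N. coeff P m * shift (m * a) (m * b) u x"
  assumes ab: "(a, b) \<noteq> (0, 0)" and u: "sq_summable u" "u (0, 0) \<noteq> 0"
    and deg: "degree G \<le> N"
    and orth: "\<And>m. m \<le> N \<Longrightarrow> ell2_inner (\<lambda>x. T G x - delta x) (shift (m * a) (m * b) u) = 0"
    and l: "cmod l \<le> 1"
  shows "poly G l \<noteq> 0"
proof
  assume "poly G l = 0"
  then obtain R where R: "G = [:- l, 1:] * R"
    by (metis poly_eq_0_iff_dvd dvdE)
  have sqT: "sq_summable (T P)" for P
    unfolding T_def by (intro sq_summable_sum sq_summable_scale) (simp add: u)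
  \<comment> \<open>If \<open>T G\<close> vanished, the case \<open>m = 0\<close> of
    \<open>orth\<close> would make \<open>delta\<close> orthogonal to \<open>u\<close>, that is,
    \<open>u (0, 0) = 0\<close>.\<close>
  have TG: "T G \<noteq> (\<lambda>x. 0)"
  proof
    assume "T G = (\<lambda>x. 0)"
    then have "ell2_inner (\<lambda>x. (-1) * delta x) u = 0"
      using orth[of 0] by simp
    then show False
      using u(2) unfolding ell2_inner_scale_left by (simp add: ell2_inner_delta)
  qed
  define F where "F = T R"
  define SF where "SF = shift a b F"
  have sq: "sq_summable F" "sq_summable SF"
    by (simp_all add: SF_def F_def sqT)
  \<comment> \<open>Dividing out the root lowers the degree by one, so \<open>S F\<close> involves
    only shifts with exponent at most \<open>N\<close>, the range where \<open>orth\<close>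
    applies.\<close>
  have zero: "coeff R N = 0"
  proof (cases "R = 0")
    case False
    then have "degree G = Suc (degree R)"
      unfolding R by (subst degree_mult_eq) auto
    with deg show ?thesis by (intro coeff_eq_0) simp
  qed simp
  have SF: "SF = (\<lambda>x. \<Sum>m<N. coeff R m * shift (Suc m * a) (Suc m * b) u x)"
  proof -
    have "SF = (\<lambda>x. \<Sum>m\<le>N. coeff R m * shift (Suc m * a) (Suc m * b) u x)"
      by (simp add: SF_def F_def T_def shift_sum shift_shift)
    then show ?thesis
      by (simp add: zero lessThan_Suc_atMost[symmetric])
  qed
  have TG_eq: "T G = (\<lambda>x. SF x - l * F x)"
  proof
    fix x
    \<comment> \<open>Coefficients of \<open>X * R - l * R\<close>; the index shift by one in the
      first term is what turns \<open>F\<close> into \<open>SF\<close>.\<close>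
    have "coeff G m = (case m of 0 \<Rightarrow> 0 | Suc k \<Rightarrow> coeff R k) - l * coeff R m" for m
      by (simp add: R coeff_pCons split: nat.split)
    then have "T G x = (\<Sum>m\<le>N. (case m of 0 \<Rightarrow> 0 | Suc k \<Rightarrow> coeff R k) * shift (m * a) (m * b) u x)
        - l * F x"
      by (simp add: T_def F_def sum_distrib_left left_diff_distrib sum_subtractf mult.assoc)
    also have "(\<Sum>m\<le>N. (case m of 0 \<Rightarrow> 0 | Suc k \<Rightarrow> coeff R k) * shift (m * a) (m * b) u x) = SF x"
      unfolding SF by (subst sum.atMost_shift) simp
    finally show "T G x = SF x - l * F x" .
  qed
  \<comment> \<open>A nontrivial shift leaves no constant coefficient, so \<open>delta\<close> is
    orthogonal to \<open>SF\<close> and can be subtracted from \<open>T G\<close> for free.\<close>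
  have "SF (0, 0) = 0"
    using ab by (auto simp: SF_def shift_def)
  then have "ell2_inner (T G) SF = ell2_inner (\<lambda>x. T G x - delta x) SF"
    using sq sqT sq_summable_delta by (simp add: ell2_inner_diff_left ell2_inner_delta)
  also have "\<dots> = (\<Sum>m<N. cnj (coeff R m) *
      ell2_inner (\<lambda>x. T G x - delta x) (shift (Suc m * a) (Suc m * b) u))"
    unfolding SF
    by (subst ell2_inner_sum_right)
       (simp_all add: sq_summable_scale u sq_summable_diff sqT sq_summable_delta ell2_inner_scale_right
         del: mult_Suc)
  also have "\<dots> = 0"
    using orth by (intro sum.neutral) (auto simp del: mult_Suc)
  finally have TGSF: "ell2_inner (T G) SF = 0" .
  \<comment> \<open>The isometry enters here: \<open>SF\<close> and \<open>F\<close> have the same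
    norm.\<close>
  moreover have "ell2_inner (T G) SF = ell2_inner F F - l * ell2_inner F SF"
    unfolding TG_eq using sq
    by (simp add: ell2_inner_diff_left sq_summable_scale ell2_inner_scale_left)
       (simp add: SF_def ell2_inner_self_shift sq)
  ultimately have FF: "l * ell2_inner F SF = ell2_inner F F" by simp
  have "ell2_inner (T G) (T G) = - cnj l * ell2_inner (T G) F"
  proof -
    have "ell2_inner (T G) (\<lambda>x. SF x - l * F x) = - cnj l * ell2_inner (T G) F"
      using sq sqT TGSF
      by (simp add: ell2_inner_diff_right sq_summable_scale ell2_inner_scale_right)
    then show ?thesis using TG_eq by simp
  qed
  also have "ell2_inner (T G) F = ell2_inner SF F - l * ell2_inner F F"
    unfolding TG_eq using sq
    by (simp add: ell2_inner_diff_left sq_summable_scale ell2_inner_scale_left)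
  also have "- cnj l * (ell2_inner SF F - l * ell2_inner F F) =
      (cmod l)\<^sup>2 * ell2_inner F F - cnj (l * ell2_inner F SF)"
    using complex_norm_square[of l] by (simp add: algebra_simps ell2_inner_commute[of SF F])
  also have "\<dots> = ((cmod l)\<^sup>2 - 1) * ell2_inner F F"
    unfolding FF by (simp add: left_diff_distrib flip: ell2_inner_commute)
  \<comment> \<open>The factor is real and, since |l| <= 1, not positive. The squared norm of the
    nonzero sequence \<open>T G\<close> would thus be at most 0.\<close>
  finally have "Re (ell2_inner (T G) (T G)) = ((cmod l)\<^sup>2 - 1) * Re (ell2_inner F F)"
    by (metis Re_complex_of_real of_real_1 of_real_diff of_real_power times_complex.sel(1)
        Im_complex_of_real mult_zero_left diff_zero)
  also have "\<dots> \<le> 0"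
    using l Re_ell2_inner_self_nonneg[OF sq(1)]
    by (intro mult_nonpos_nonneg) (auto simp: power_le_one)
  finally show False
    using TG ell2_inner_self_le_0D[OF sqT] by blast
qed

section \<open>Power series on the bidisk and their Taylor coefficients\<close>

lemma power_series_deriv:
  fixes f :: "complex \<Rightarrow> complex"
  assumes "\<And>w. cmod w < 1 \<Longrightarrow> (\<lambda>n. a n * w ^ n) sums f w"
  shows "(deriv ^^ n) f 0 = fact n * a n"
proof -
  have "conv_radius a \<ge> 1"
  proof (rule conv_radius_geI_ex)
    fix r :: real assume "0 < r" "ereal r < 1"
    then show "\<exists>z. norm z = r \<and> summable (\<lambda>n. a n * z ^ n)"
      using assms[of "of_real r"] by (intro exI[of _ "of_real r"]) (auto simp: sums_iff)
  qed
  then have "fps_conv_radius (Abs_fps a) > 0"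
    unfolding fps_conv_radius_def by (simp add: order_less_le_trans[OF ereal_0_less_1])
  moreover have "eventually (\<lambda>w. eval_fps (Abs_fps a) w = f w) (nhds 0)"
    unfolding eventually_nhds
    by (rule exI[of _ "ball 0 1"]) (use assms in \<open>auto simp: eval_fps_def sums_iff\<close>)
  ultimately have "f has_fps_expansion Abs_fps a"
    by (simp add: has_fps_expansion_def zero_ereal_def)
  from fps_nth_fps_expansion[OF this, of n] show ?thesis
    by (simp add: field_simps)
qed

text \<open>Unordered convergence at every point of the bidisk passes to sums, multiples and shifts,
  and it determines \<open>taylor_coeff2\<close>. Coefficients of products can thus be found without
  iterated derivatives.\<close>

definition has_expansion2 :: "(complex \<times> complex \<Rightarrow> complex) \<Rightarrow> (nat \<times> nat \<Rightarrow> complex) \<Rightarrow> bool" where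
  "has_expansion2 F c \<longleftrightarrow> (\<forall>z w. cmod z < 1 \<longrightarrow> cmod w < 1 \<longrightarrow>
     ((\<lambda>x. c x * (z ^ fst x * w ^ snd x)) has_sum F (z, w)) UNIV)"

text \<open>For fixed \<open>z\<close>, grouping by powers of \<open>w\<close> gives a one-variable
  series with coefficients \<open>A j z\<close>, each itself a power series in \<open>z\<close>. The
  one-variable result applies first in \<open>w\<close>, then in \<open>z\<close>.\<close>

lemma taylor_coeff2_expansion:
  assumes "has_expansion2 F c"
  shows "taylor_coeff2 F i j = c (i, j)"
proof -
  define A where "A j z = (\<Sum>\<^sub>\<infinity>i. c (i, j) * z ^ i)" for j z
  have sum: "((\<lambda>x. c x * (z ^ fst x * w ^ snd x)) has_sum F (z, w)) UNIV"
    if "cmod z < 1" "cmod w < 1" for z w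
    using assms that by (simp add: has_expansion2_def)
  have A: "((\<lambda>i. c (i, j) * z ^ i) has_sum A j z) UNIV" if "cmod z < 1" for z j
  proof -
    \<comment> \<open>The value 1/2 is just a nonzero point of the disk: the double series there
      contains the row \<open>j\<close>, scaled by a factor that multiplying by \<open>2 ^ j\<close>
      removes.\<close>
    have "(\<lambda>x. c x * (z ^ fst x * (1 / 2) ^ snd x)) summable_on range (\<lambda>i. (i, j))"
      using sum[OF that, of "1 / 2"]
      by (intro summable_on_subset_banach[OF has_sum_imp_summable]) auto
    then have "(\<lambda>i. c (i, j) * (z ^ i * (1 / 2) ^ j)) summable_on UNIV"
      by (subst (asm) summable_on_reindex) (auto simp: inj_on_def o_def)
    then have "(\<lambda>i. 2 ^ j * (c (i, j) * (z ^ i * (1 / 2) ^ j))) summable_on UNIV"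
      by (rule summable_on_cmult_right)
    then have "(\<lambda>i. c (i, j) * z ^ i) summable_on UNIV"
      by (simp add: power_divide)
    then show ?thesis
      unfolding A_def by (rule has_sum_infsum)
  qed
  have "(\<lambda>j. A j z * w ^ j) sums F (z, w)" if "cmod z < 1" "cmod w < 1" for z w
  proof (rule has_sum_imp_sums, rule has_sum_SigmaD)
    show "((\<lambda>(j, i). c (i, j) * (z ^ i * w ^ j)) has_sum F (z, w)) (UNIV \<times> UNIV)"
      using sum[OF that] by (subst has_sum_swap) (simp add: case_prod_unfold)
    show "((\<lambda>i. case (j, i) of (j, i) \<Rightarrow> c (i, j) * (z ^ i * w ^ j)) has_sum A j z * w ^ j) UNIV" for j
      using has_sum_cmult_left[OF A[OF that(1)], of j "w ^ j"] by (simp add: mult.assoc)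
  qed
  then have "(deriv ^^ j) (\<lambda>w. F (z, w)) 0 = fact j * A j z" if "cmod z < 1" for z
    using that by (intro power_series_deriv)
  then have "(\<lambda>i. fact j * c (i, j) * z ^ i) sums (deriv ^^ j) (\<lambda>w. F (z, w)) 0" if "cmod z < 1" for z
    using sums_mult[OF has_sum_imp_sums[OF A[OF that]], of "fact j" j] that by (simp add: mult.assoc)
  from power_series_deriv[OF this] show ?thesis
    by (simp add: taylor_coeff2_def)
qed

lemma has_expansion2_delta: "has_expansion2 (\<lambda>_. 1) delta"
  unfolding has_expansion2_def
  by (intro allI impI has_sum_finite_neutralI[of "{(0, 0)}"]) (auto simp: delta_def)

lemma has_expansion2_add:
  assumes "has_expansion2 F c" "has_expansion2 G d"
  shows "has_expansion2 (\<lambda>x. F x + G x) (\<lambda>x. c x + d x)"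
  using assms by (auto simp: has_expansion2_def distrib_right intro!: has_sum_add)

lemma has_expansion2_scale:
  assumes "has_expansion2 F c"
  shows "has_expansion2 (\<lambda>x. k * F x) (\<lambda>x. k * c x)"
  using assms by (auto simp: has_expansion2_def mult.assoc intro!: has_sum_cmult_right)

lemma has_expansion2_diff:
  assumes "has_expansion2 F c" "has_expansion2 G d"
  shows "has_expansion2 (\<lambda>x. F x - G x) (\<lambda>x. c x - d x)"
  using has_expansion2_add[OF assms(1) has_expansion2_scale[OF assms(2), of "-1"]] by simp

lemma has_expansion2_sum:
  assumes "\<And>l. l \<in> A \<Longrightarrow> has_expansion2 (F l) (c l)"
  shows "has_expansion2 (\<lambda>x. \<Sum>l\<in>A. F l x) (\<lambda>x. \<Sum>l\<in>A. c l x)"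
  using assms
proof (induction A rule: infinite_finite_induct)
  case (insert l A)
  then show ?case
    using has_expansion2_add[of "F l" "c l" "\<lambda>x. \<Sum>l\<in>A. F l x" "\<lambda>x. \<Sum>l\<in>A. c l x"] by simp
qed (auto simp: has_expansion2_def)

lemma has_expansion2_shift:
  assumes "has_expansion2 F c"
  shows "has_expansion2 (\<lambda>x. (fst x ^ s * snd x ^ t) * F x) (shift s t c)"
  unfolding has_expansion2_def
proof (intro allI impI)
  fix z w :: complex assume "cmod z < 1" "cmod w < 1"
  then have "((\<lambda>x. (z ^ s * w ^ t) * (c x * (z ^ fst x * w ^ snd x))) has_sum
      (z ^ s * w ^ t) * F (z, w)) UNIV"
    using assms by (intro has_sum_cmult_right) (simp add: has_expansion2_def)
  then show "((\<lambda>x. shift s t c x * (z ^ fst x * w ^ snd x)) has_sum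
      (fst (z, w) ^ s * snd (z, w) ^ t) * F (z, w)) UNIV"
    by (subst has_sum_shift[where g = "\<lambda>x y. y * (z ^ fst x * w ^ snd x)"])
       (simp_all add: case_prod_unfold power_add mult_ac)
qed

text \<open>Carries the Hardy norm over to sequences, where the projection argument takes
  place.\<close>

lemma hardy_norm2_expansion:
  assumes "has_expansion2 F c" "sq_summable c"
  shows "hardy_norm2 F = sqrt (Re (ell2_inner c c))"
  by (simp add: hardy_norm2_def taylor_coeff2_expansion[OF assms(1)] ell2_inner_self assms(2)
      case_prod_unfold)

section \<open>Functions of a single monomial\<close>

definition ray :: "nat \<Rightarrow> nat \<Rightarrow> nat \<Rightarrow> nat \<times> nat" where
  "ray a b m = (m * a, m * b)"

text \<open>\<open>inv\<close> recovers the exponent \<open>m\<close> because \<open>ray a b\<close>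
  is injective for \<open>(a, b)\<close> other than \<open>(0, 0)\<close>.\<close>

definition ray_coeffs :: "nat \<Rightarrow> nat \<Rightarrow> (nat \<Rightarrow> complex) \<Rightarrow> nat \<times> nat \<Rightarrow> complex" where
  "ray_coeffs a b \<alpha> x = (if x \<in> range (ray a b) then \<alpha> (inv (ray a b) x) else 0)"

lemma inj_ray: "(a, b) \<noteq> (0, 0) \<Longrightarrow> inj (ray a b)"
  by (auto simp: inj_def ray_def)

lemma ray_coeffs_ray:
  assumes "(a, b) \<noteq> (0, 0)"
  shows "ray_coeffs a b \<alpha> (ray a b m) = \<alpha> m"
  by (simp add: ray_coeffs_def inj_ray[OF assms])

lemma has_sum_ray_coeffs:
  fixes g :: "nat \<times> nat \<Rightarrow> complex \<Rightarrow> 'b :: {comm_monoid_add, topological_space}"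
  assumes "(a, b) \<noteq> (0, 0)" "\<And>x. g x 0 = 0"
  shows "((\<lambda>x. g x (ray_coeffs a b \<alpha> x)) has_sum S) UNIV \<longleftrightarrow>
    ((\<lambda>m. g (ray a b m) (\<alpha> m)) has_sum S) UNIV"
proof -
  have "((\<lambda>x. g x (ray_coeffs a b \<alpha> x)) has_sum S) UNIV \<longleftrightarrow>
      ((\<lambda>x. g x (ray_coeffs a b \<alpha> x)) has_sum S) (range (ray a b))"
    by (intro has_sum_cong_neutral) (auto simp: assms ray_coeffs_def)
  also have "\<dots> \<longleftrightarrow> ((\<lambda>x. g x (ray_coeffs a b \<alpha> x)) \<circ> ray a b has_sum S) UNIV"
    by (rule has_sum_reindex[OF inj_ray[OF assms(1)]])
  finally show ?thesis
    unfolding o_def ray_coeffs_ray[OF assms(1)] .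
qed

lemma sq_summable_ray_coeffs:
  assumes "(a, b) \<noteq> (0, 0)" "summable (\<lambda>m. (cmod (\<alpha> m))\<^sup>2)"
  shows "sq_summable (ray_coeffs a b \<alpha>)"
  using assms(2) has_sum_ray_coeffs[OF assms(1), of "\<lambda>_ y. (cmod y)\<^sup>2" \<alpha>]
  by (simp add: sq_summable_def summable_on_def flip: summable_on_UNIV_nonneg_real_iff)

lemma norm_monomial_less_1:
  fixes z w :: complex
  assumes "(a, b) \<noteq> (0, 0)" "cmod z < 1" "cmod w < 1"
  shows "cmod (z ^ a * w ^ b) < 1"
proof (cases "a = 0")
  case True
  then show ?thesis
    using assms by (simp add: norm_mult norm_power power_less_one_iff)
next
  case False
  have "cmod z ^ a * cmod w ^ b \<le> cmod z ^ a"
    using assms by (intro mult_left_le) (auto simp: power_le_one)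
  also have "\<dots> < 1"
    using False assms by (simp add: power_less_one_iff)
  finally show ?thesis
    by (simp add: norm_mult norm_power)
qed

lemma has_expansion2_ray:
  assumes ab: "(a, b) \<noteq> (0, 0)" and h: "h holomorphic_on ball 0 1"
    and f: "\<And>z w. cmod z < 1 \<Longrightarrow> cmod w < 1 \<Longrightarrow> f (z, w) = h (z ^ a * w ^ b)"
  shows "has_expansion2 f (ray_coeffs a b (\<lambda>n. (deriv ^^ n) h 0 / fact n))"
  unfolding has_expansion2_def
proof (intro allI impI)
  fix z w :: complex assume zw: "cmod z < 1" "cmod w < 1"
  define \<alpha> where "\<alpha> = (\<lambda>n. (deriv ^^ n) h 0 / fact n)"
  define y where "y = z ^ a * w ^ b"
  have sums: "(\<lambda>n. \<alpha> n * x ^ n) sums h x" if "cmod x < 1" for x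
    using holomorphic_power_series[OF h, of x] that by (simp add: \<alpha>_def)
  have y: "cmod y < 1"
    unfolding y_def using ab zw by (rule norm_monomial_less_1)
  \<comment> \<open>An unordered sum needs absolute convergence at \<open>y\<close>, which follows
    from convergence at a point of larger modulus \<open>r\<close>.\<close>
  then obtain r where r: "cmod y < r" "r < 1"
    using dense by blast
  have "summable (\<lambda>n. \<alpha> n * of_real r ^ n)"
    using r norm_ge_zero[of y] by (intro sums_summable[OF sums]) (simp del: norm_ge_zero)
  then have "summable (\<lambda>n. norm (\<alpha> n * y ^ n))"
    by (rule powser_insidea) (use r norm_ge_zero[of y] in \<open>simp del: norm_ge_zero\<close>)
  then have "((\<lambda>n. \<alpha> n * y ^ n) has_sum h y) UNIV"
    using sums[OF y] by (rule norm_summable_imp_has_sum)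
  moreover have "y ^ n = z ^ (n * a) * w ^ (n * b)" for n
    by (simp add: y_def power_mult_distrib mult.commute[of n] power_mult)
  ultimately show "((\<lambda>x. ray_coeffs a b (\<lambda>n. (deriv ^^ n) h 0 / fact n) x * (z ^ fst x * w ^ snd x))
      has_sum f (z, w)) UNIV"
    using has_sum_ray_coeffs[OF ab, of "\<lambda>x y. y * (z ^ fst x * w ^ snd x)" \<alpha> "h y"] f[OF zw]
    by (simp add: ray_def y_def \<alpha>_def)
qed

lemma holomorphic2_on_monomial_comp:
  assumes ab: "(a, b) \<noteq> (0, 0)" and h: "h holomorphic_on ball 0 1"
    and f: "\<And>z w. cmod z < 1 \<Longrightarrow> cmod w < 1 \<Longrightarrow> f (z, w) = h (z ^ a * w ^ b)"
  shows "holomorphic2_on f bidisk"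
  unfolding holomorphic2_on_def
proof
  fix x assume x: "x \<in> bidisk"
  define y where "y = fst x ^ a * snd x ^ b"
  have "y \<in> ball 0 1"
    using norm_monomial_less_1[OF ab] x by (auto simp: y_def bidisk_def)
  then obtain D where "(h has_field_derivative D) (at y)"
    using h by (meson holomorphic_on_imp_differentiable_at open_ball field_differentiable_def)
  then have D: "(h has_derivative (\<lambda>v. D * v)) (at (fst x ^ a * snd x ^ b))"
    by (simp add: has_field_derivative_def y_def)
  define p where "p = of_nat a * fst x ^ (a - 1) * snd x ^ b"
  define q where "q = of_nat b * snd x ^ (b - 1) * fst x ^ a"
  have "((\<lambda>x. fst x ^ a * snd x ^ b) has_derivative (\<lambda>v. p * fst v + q * snd v)) (at x)"
    unfolding p_def q_def by (auto intro!: derivative_eq_intros simp: algebra_simps)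
  from has_derivative_compose[OF this D]
  have "((\<lambda>x. h (fst x ^ a * snd x ^ b)) has_derivative (\<lambda>(u, v). (D * p) * u + (D * q) * v)) (at x)"
    by (simp add: case_prod_unfold algebra_simps)
  \<comment> \<open>\<open>f\<close> is tied to \<open>h\<close> on the bidisk, which is open, so
    the derivative of the composite transfers to \<open>f\<close>.\<close>
  then have "(f has_derivative (\<lambda>(u, v). (D * p) * u + (D * q) * v)) (at x)"
  proof (rule has_derivative_transform_within_open[where s = bidisk])
    show "open bidisk" by (simp add: bidisk_def open_Times)
    show "h (fst x ^ a * snd x ^ b) = f x" if "x \<in> bidisk" for x
      using that f by (auto simp: bidisk_def)
  qed (rule x)
  then show "\<exists>a b. (f has_derivative (\<lambda>(u, v). a * u + b * v)) (at x)"
    by blast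
qed

section \<open>The monomial order, and uniqueness of the approximant\<close>

lemma prod_encode_mono:
  assumes "i \<le> i'" "j \<le> j'"
  shows "prod_encode (i, j) \<le> prod_encode (i', j')"
  using assms by (simp add: prod_encode_def triangle_def add_mono div_le_mono mult_le_mono)

text \<open>Coefficients of \<open>chi l * f\<close> if \<open>u\<close> holds those of
  \<open>f\<close>; the components are swapped because the first one of \<open>prod_decode l\<close>
  is the exponent of \<open>w\<close>.\<close>

abbreviation chi_shift :: "(nat \<times> nat \<Rightarrow> complex) \<Rightarrow> nat \<Rightarrow> nat \<times> nat \<Rightarrow> complex" where
  "chi_shift u l \<equiv> shift (snd (prod_decode l)) (fst (prod_decode l)) u"

text \<open>Only multiples of \<open>chi l\<close> occur in \<open>chi l * f\<close>, and they never
  precede \<open>chi l\<close> in the enumeration.\<close>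

lemma chi_shift_eq_0:
  assumes "prod_encode (snd x, fst x) < l"
  shows "chi_shift u l x = 0"
proof (rule ccontr)
  assume "chi_shift u l x \<noteq> 0"
  then have "prod_encode (fst (prod_decode l), snd (prod_decode l)) \<le> prod_encode (snd x, fst x)"
    by (intro prod_encode_mono) (auto simp: shift_def split: prod.splits if_splits)
  then show False using assms by simp
qed

text \<open>The system is triangular: at the position of \<open>chi l\<close>, earlier terms drop
  out by induction and later ones by \<open>chi_shift_eq_0\<close>, leaving
  \<open>d l * u (0, 0)\<close>.\<close>

lemma chi_shift_independent:
  fixes d :: "nat \<Rightarrow> complex"
  assumes u: "u (0, 0) \<noteq> 0" and zero: "\<And>x. (\<Sum>l\<le>n. d l * chi_shift u l x) = 0"
    and l: "l \<le> n"
  shows "d l = 0"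
  using l
proof (induction l rule: less_induct)
  case (less l)
  define x where "x = (snd (prod_decode l), fst (prod_decode l))"
  have "d l' * chi_shift u l' x = 0" if "l' \<in> {..n} - {l}" for l'
  proof (cases "l' < l")
    case True
    then show ?thesis using less by simp
  next
    case False
    then show ?thesis using that chi_shift_eq_0[of x l' u] by (simp add: x_def)
  qed
  then have "(\<Sum>l'\<in>{..n} - {l}. d l' * chi_shift u l' x) = 0"
    by (intro sum.neutral) blast
  then have "(\<Sum>l\<le>n. d l * chi_shift u l x) = d l * chi_shift u l x"
    using less.prems by (subst sum.remove[of _ l]) simp_all
  then show ?case
    using zero[of x] u by (simp add: x_def shift_def)
qed

text \<open>By Pythagoras, another candidate \<open>d\<close> exceeds the squared distance of
  \<open>c\<close> by the squared norm of \<open>L (d - c)\<close>. This yields minimality; equality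
  forces \<open>L (d - c) = 0\<close>, and independence then gives the uniqueness that
  \<open>THE\<close> requires.\<close>

lemma opa_eqI:
  fixes c :: "nat \<Rightarrow> complex"
  assumes f: "f \<in> hardy_bidisk" "\<exists>x\<in>bidisk. f x \<noteq> 0"
    and u: "has_expansion2 f u" "sq_summable u" "u (0, 0) \<noteq> 0"
    and orth: "\<And>l. l \<le> n \<Longrightarrow>
      ell2_inner (\<lambda>x. (\<Sum>l\<le>n. c l * chi_shift u l x) - delta x) (chi_shift u l) = 0"
  shows "opa n f = (\<lambda>x. \<Sum>l\<le>n. c l * chi l x)"
proof -
  \<comment> \<open>\<open>L d\<close> and \<open>U d\<close> are the coefficient sequences of
    \<open>P d * f\<close> and \<open>P d * f - 1\<close>.\<close>
  define P where "P = (\<lambda>d x. \<Sum>l\<le>n. d l * chi l x)"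
  define L where "L = (\<lambda>d x. \<Sum>l\<le>n. d l * chi_shift u l x)"
  define U where "U = (\<lambda>d x. L d x - delta x)"
  have sqL: "sq_summable (L d)" for d
    unfolding L_def using u by (intro sq_summable_sum sq_summable_scale) simp
  have sqU: "sq_summable (U d)" for d
    unfolding U_def by (intro sq_summable_diff sqL sq_summable_delta)
  have norm: "hardy_norm2 (\<lambda>x. P d x * f x - 1) = sqrt (Re (ell2_inner (U d) (U d)))" for d
  proof (rule hardy_norm2_expansion)
    have "has_expansion2 (\<lambda>x. (\<Sum>l\<le>n. d l * ((fst x ^ snd (prod_decode l) * snd x ^ fst (prod_decode l)) * f x)) - 1) (U d)"
      unfolding U_def L_def
      by (intro has_expansion2_diff has_expansion2_sum has_expansion2_scale has_expansion2_shift has_expansion2_delta u)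
    moreover have "(\<lambda>x. P d x * f x - 1) =
        (\<lambda>x. (\<Sum>l\<le>n. d l * ((fst x ^ snd (prod_decode l) * snd x ^ fst (prod_decode l)) * f x)) - 1)"
      by (simp add: P_def chi_def sum_distrib_right mult.assoc case_prod_unfold)
    ultimately show "has_expansion2 (\<lambda>x. P d x * f x - 1) (U d)" by simp
  qed (rule sqU)
  have "ell2_inner (U c) (L e) = 0" for e
    unfolding L_def using u orth sqU[of c]
    by (subst ell2_inner_sum_right)
       (auto simp: sq_summable_scale ell2_inner_scale_right U_def L_def intro!: sum.neutral)
  moreover have "U d = (\<lambda>x. U c x + L (\<lambda>l. d l - c l) x)" for d
    by (simp add: U_def L_def left_diff_distrib sum_subtractf)
  ultimately have pyth: "Re (ell2_inner (U d) (U d)) = Re (ell2_inner (U c) (U c)) +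
      Re (ell2_inner (L (\<lambda>l. d l - c l)) (L (\<lambda>l. d l - c l)))" for d
    using ell2_pythagoras[OF sqU[of c] sqL] by (metis plus_complex.sel(1))
  have space: "poly_space n = range P"
    by (auto simp: poly_space_def P_def)
  have min: "Re (ell2_inner (U c) (U c)) \<le> Re (ell2_inner (U d) (U d))" for d
    using pyth[of d] Re_ell2_inner_self_nonneg[OF sqL] by simp
  have "is_opa n f (P c)"
    unfolding is_opa_def space
    using f by (auto simp: norm min)
  moreover have "p = P c" if opa: "is_opa n f p" for p
  proof -
    obtain d where p: "p = P d"
      using opa unfolding is_opa_def space by blast
    have "hardy_norm2 (\<lambda>x. P d x * f x - 1) \<le> hardy_norm2 (\<lambda>x. P c x * f x - 1)"
      using that by (auto simp: is_opa_def p space)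
    then have "Re (ell2_inner (L (\<lambda>l. d l - c l)) (L (\<lambda>l. d l - c l))) \<le> 0"
      by (simp add: norm pyth[of d])
    then have "L (\<lambda>l. d l - c l) = (\<lambda>x. 0)"
      by (rule ell2_inner_self_le_0D[OF sqL])
    then have "(\<Sum>l\<le>n. (d l - c l) * chi_shift u l x) = 0" for x
      unfolding L_def by (rule fun_cong)
    \<comment> \<open>Coefficients past \<open>n\<close> may differ, but \<open>P\<close> does not
      see them.\<close>
    then have "d l - c l = 0" if "l \<le> n" for l
      using chi_shift_independent[where d = "\<lambda>l. d l - c l" and u = u] u(3) that by blast
    then show ?thesis
      by (simp add: p P_def)
  qed
  ultimately show ?thesis
    unfolding opa_def P_def by (rule the_equality)
qed

section \<open>Reduction to one variable along the ray of powers of \<open>chi k\<close>\<close>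

theorem theorem4p2:
  fixes h :: "complex \<Rightarrow> complex" and f :: "complex \<times> complex \<Rightarrow> complex" and k n :: nat
  assumes "h \<in> hardy_disk" and "h 0 \<noteq> 0"
    and "k \<ge> 1"
    and "\<And>x. x \<in> bidisk \<Longrightarrow> f x = h (chi k x)"
  shows "\<forall>x\<in>closed_bidisk. opa n f x \<noteq> 0"
proof
  fix x :: "complex \<times> complex" assume x: "x \<in> closed_bidisk"
  define a where "a = snd (prod_decode k)"
  define b where "b = fst (prod_decode k)"
  define \<alpha> where "\<alpha> = (\<lambda>n. (deriv ^^ n) h 0 / fact n)"
  define u where "u = ray_coeffs a b \<alpha>"
  have k: "prod_encode (b, a) = k"
    by (simp add: a_def b_def)
  have ab: "(a, b) \<noteq> (0, 0)"
  proof
    assume "(a, b) = (0, 0)"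
    then have "k = prod_encode (0, 0)" using k by simp
    then show False using \<open>k \<ge> 1\<close> by (simp add: prod_encode_def)
  qed
  have holh: "h holomorphic_on ball 0 1" and sumh: "summable (\<lambda>n. (cmod (\<alpha> n))\<^sup>2)"
    using assms(1) by (auto simp: hardy_disk_def \<alpha>_def)
  have chik: "chi k (z, w) = z ^ a * w ^ b" for z w
    by (simp add: chi_def a_def b_def)
  have f: "f (z, w) = h (z ^ a * w ^ b)" if "cmod z < 1" "cmod w < 1" for z w
    using assms(4)[of "(z, w)"] that by (simp add: bidisk_def chik)
  have u: "has_expansion2 f u" "sq_summable u"
    unfolding u_def \<alpha>_def using has_expansion2_ray[OF ab holh f] sq_summable_ray_coeffs[OF ab sumh]
    by (auto simp: \<alpha>_def)
  have u0: "u (0, 0) \<noteq> 0"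
    using ray_coeffs_ray[OF ab, of \<alpha> 0] assms(2) by (simp add: u_def ray_def \<alpha>_def)
  have fH: "f \<in> hardy_bidisk"
    using holomorphic2_on_monomial_comp[OF ab holh f] u
    by (simp add: hardy_bidisk_def taylor_coeff2_expansion[OF u(1)] sq_summable_def
        case_prod_unfold)
  have f0: "\<exists>x\<in>bidisk. f x \<noteq> 0"
    using f[of 0 0] ab assms(2) by (intro bexI[of _ "(0, 0)"]) (auto simp: bidisk_def power_0_left)

  \<comment> \<open>\<open>enc m\<close> is the index of the \<open>m\<close>-th power of
    \<open>chi k\<close>. By monotonicity the powers lying in \<open>poly_space n\<close> are
    exactly those with exponent at most \<open>N\<close>.\<close>
  define enc where "enc m = prod_encode (m * b, m * a)" for m
  define M where "M = {m. enc m \<le> n}"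
  define N where "N = Max M"
  have "m \<le> enc m" for m
    using ab le_prod_encode_1[of "m * b" "m * a"] le_prod_encode_2[of "m * a" "m * b"]
    unfolding enc_def by (cases "a = 0") (auto intro: order_trans[rotated])
  then have "M \<subseteq> {..n}"
    unfolding M_def using order_trans by blast
  then have "finite M"
    by (rule finite_subset) simp
  moreover have "0 \<in> M"
    by (simp add: M_def enc_def prod_encode_def)
  ultimately have "N \<in> M" and "m \<in> M \<Longrightarrow> m \<le> N" for m
    unfolding N_def by (auto intro: Max_in Max_ge)
  moreover have "enc m \<le> enc m'" if "m \<le> m'" for m m'
    using that unfolding enc_def by (intro prod_encode_mono) simp_all
  ultimately have N: "enc m \<le> n \<longleftrightarrow> m \<le> N" for m
    by (auto simp: M_def intro: order_trans)

  define W where "W m = shift (m * a) (m * b) u" for m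
  \<comment> \<open>Projects 1 onto the span of the products of \<open>f\<close> with these powers.
    The projection lemma uses a strict bound, hence \<open>Suc N\<close>.\<close>
  obtain g where g: "\<And>i. i \<le> N \<Longrightarrow> ell2_inner (\<lambda>x. delta x - (\<Sum>m\<le>N. g m * W m x)) (W i) = 0"
    using ell2_projection_exists[of W delta "Suc N"] sq_summable_delta u(2)
    by (auto simp: W_def less_Suc_eq_le lessThan_Suc_atMost)
  define r where "r = (\<lambda>x. (\<Sum>m\<le>N. g m * W m x) - delta x)"
  have r: "ell2_inner r (W i) = 0" if "i \<le> N" for i
    using ell2_inner_scale_left[of "-1" "\<lambda>x. delta x - (\<Sum>m\<le>N. g m * W m x)" "W i"] g[OF that]
    by (simp add: r_def)
  define G where "G = (\<Sum>m\<le>N. monom (g m) m)"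
  have coeffG: "coeff G m = (if m \<le> N then g m else 0)" for m
    by (simp add: G_def coeff_sum)
  have degG: "degree G \<le> N"
    by (intro degree_le) (simp add: coeffG)
  \<comment> \<open>Places \<open>g m\<close> at index \<open>enc m\<close> and 0 elsewhere. In the
    sum form, exchanging the two sums turns a sum over \<open>l\<close> into one over
    \<open>m\<close>; no term is lost since \<open>enc m <= n\<close> for
    \<open>m <= N\<close>.\<close>
  define c where "c l = (\<Sum>m\<le>N. if l = enc m then g m else 0)" for l
  have c: "(\<Sum>l\<le>n. c l * Y l) = (\<Sum>m\<le>N. g m * Y (enc m))" for Y
  proof -
    have "(\<Sum>l\<le>n. c l * Y l) = (\<Sum>m\<le>N. \<Sum>l\<le>n. if l = enc m then g m * Y l else 0)"
      unfolding c_def sum_distrib_right by (subst sum.swap) (intro sum.cong refl, simp)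
    also have "\<dots> = (\<Sum>m\<le>N. g m * Y (enc m))"
      by (intro sum.cong refl) (simp add: N)
    finally show ?thesis .
  qed
  have cW: "(\<Sum>l\<le>n. c l * chi_shift u l y) = (\<Sum>m\<le>N. g m * W m y)" for y
    by (simp add: c enc_def W_def)
  have rc: "(\<lambda>x. (\<Sum>l\<le>n. c l * chi_shift u l x) - delta x) = r"
    by (simp add: cW r_def)

  have supp_u: "y \<in> range (ray a b)" if "u y \<noteq> 0" for y
    using that by (auto simp: u_def ray_coeffs_def split: if_splits)
  have supp_shift: "\<exists>m. y = (s + m * a, t + m * b)" if "shift s t u y \<noteq> 0" for s t y
  proof -
    have y: "s \<le> fst y" "t \<le> snd y" "u (fst y - s, snd y - t) \<noteq> 0"
      using that by (auto simp: shift_def split: prod.splits if_splits)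
    then obtain m where "(fst y - s, snd y - t) = ray a b m"
      using supp_u by blast
    then have "y = (s + m * a, t + m * b)"
      using y(1,2) by (auto simp: ray_def prod_eq_iff)
    then show ?thesis by blast
  qed
  \<comment> \<open>\<open>delta\<close> sits at the origin, the ray point with
    \<open>m = 0\<close>, and each \<open>W m\<close> moves the ray into itself.\<close>
  have supp_r: "y \<in> range (ray a b)" if ry: "r y \<noteq> 0" for y
  proof (cases "y = (0, 0)")
    case True
    then show ?thesis by (auto simp: ray_def intro!: image_eqI[of _ _ 0])
  next
    case False
    then have "(\<Sum>m\<le>N. g m * W m y) \<noteq> 0"
      using ry by (simp add: r_def delta_def)
    then obtain m where "W m y \<noteq> 0"
      by (metis (no_types, lifting) mult_zero_right sum.neutral)
    then obtain m' where "y = (m * a + m' * a, m * b + m' * b)"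
      unfolding W_def using supp_shift by blast
    then have "y = ray a b (m + m')"
      by (simp add: ray_def distrib_right)
    then show ?thesis by blast
  qed
  have "ell2_inner (\<lambda>x. (\<Sum>l\<le>n. c l * chi_shift u l x) - delta x) (chi_shift u l) = 0" if l: "l \<le> n" for l
  proof (cases "l \<in> range enc")
    case True
    then show ?thesis unfolding rc using r l N by (auto simp: W_def enc_def)
  next
    \<comment> \<open>If \<open>chi l\<close> is not a power of \<open>chi k\<close>, its shift of
      \<open>u\<close> misses the ray that carries \<open>r\<close>: a common point would make
      \<open>chi l\<close> a quotient of two such powers.\<close>
    case False
    show ?thesis
      unfolding rc
    proof (rule ell2_inner_disjoint, rule ccontr)
      fix y assume "\<not> (r y = 0 \<or> chi_shift u l y = 0)"
      then have "r y \<noteq> 0" and shift: "chi_shift u l y \<noteq> 0" by auto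
      then obtain m where m: "y = (m * a, m * b)"
        using supp_r unfolding ray_def by blast
      obtain m' where m': "y = (snd (prod_decode l) + m' * a, fst (prod_decode l) + m' * b)"
        using supp_shift[OF shift] by blast
      have "snd (prod_decode l) + m' * a = m * a" "fst (prod_decode l) + m' * b = m * b"
        using m m' by auto
      \<comment> \<open>Truncated subtraction is exact here, as both equations exhibit the
        difference of the products as a natural number.\<close>
      then have "snd (prod_decode l) = (m - m') * a" "fst (prod_decode l) = (m - m') * b"
        unfolding diff_mult_distrib by linarith+
      then have "l = enc (m - m')"
        unfolding enc_def by (metis prod.collapse prod_decode_inverse)
      with False show False by blast
    qed
  qed
  then have "opa n f = (\<lambda>x. \<Sum>l\<le>n. c l * chi l x)"
    by (rule opa_eqI[OF fH f0 u u0])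
  moreover have "chi (enc m) x = chi k x ^ m" for m
    by (cases x) (simp add: a_def b_def chi_def enc_def power_mult_distrib mult.commute[of m]
        power_mult)
  \<comment> \<open>At \<open>x\<close> the approximant is \<open>G\<close> evaluated at
    \<open>chi k x\<close>, a point of the closed unit disk, where \<open>G\<close> has no
    root.\<close>
  ultimately have "opa n f x = (\<Sum>m\<le>N. g m * chi k x ^ m)"
    by (simp add: c)
  also have "\<dots> = poly G (chi k x)"
    by (simp add: G_def poly_sum poly_monom)
  also have "\<dots> \<noteq> 0"
  proof (rule orthogonal_poly_no_root[OF ab u(2) u0 degG])
    show "cmod (chi k x) \<le> 1"
      using x by (cases x) (auto simp: chik closed_bidisk_def norm_mult norm_power power_le_one mult_le_one)
    show "ell2_inner (\<lambda>x. (\<Sum>m\<le>N. coeff G m * shift (m * a) (m * b) u x) - delta x)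
        (shift (i * a) (i * b) u) = 0" if "i \<le> N" for i
      using r[OF that] by (simp add: r_def W_def coeffG)
  qed
  finally show "opa n f x \<noteq> 0" .
qed

end
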